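(* Let $d\ge2$, let $r\in\,]0,1[$, and consider a system of three inelastic particles $0,1,2$ in $\mathbb{R}^d$ evolving according to the $r$-inelastic hard sphere flow on a time interval $[0,\tau^*[$ and undergoing an inelastic collapse at time $\tau^*>0$. Assume that, for some $(i,j)\in\{(0,1),(0,2),(1,2)\}$, the pair of particles $i$-$j$ collides infinitely many times, and that the system has a finite maximal gap of type $(i,j)$. Let $\eta_{(i,j),n}$ denote the normal component of the relative velocity between the particles $i$ and $j$ just before the $n$-th collision of the system. Then the sequence $(\eta_{(i,j),n})_n$ is square summable, that is $(\eta_{(i,j),n})_n\in\ell^2$. In particular, $$\eta_{(i,j),n}\xrightarrow[n\to+\infty]{}0.$$
   Context: Model. Three identical spherical particles $0,1,2$ of diameter $1$ in $\mathbb{R}^d$ ($d\ge2$), with positions $x_i$ and velocities $v_i$, and $|x_i-x_j|\ge1$ for $i\ne j$. The $r$-inelastic hard sphere flow, $r\in\,]0,1[$: between collisions each particle moves in a straight line with constant velocity; when $|x_i-x_j|=1$ for a pair $i\neq j$ (a collision of type $i$-$j$), the velocities of these two particles are immediately changed into $v_i'=v_i-\frac{1+r}{2}\big((v_i-v_j)\cdot\omega\big)\omega$ and $v_j'=v_j+\frac{1+r}{2}\big((v_i-v_j)\cdot\omega\big)\omega$, with $\omega=(x_i-x_j)/|x_i-x_j|$, the velocity of the third particle being unchanged. Inelastic collapse at time $\tau^*>0$: the system evolves according to this flow on $[0,\tau^*[$ and there is an increasing sequence $(t_n)_{n\in\mathbb{N}}$ with $t_0=0$, $t_n\to\tau^*$,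 such that the $t_n$ are exactly the times of collisions (no accumulation point other than $\tau^*$, free motion on each $]t_n,t_{n+1}[$). Only well-defined trajectories are considered: no triple collision and no grazing collision takes place on $[0,\tau^*[$. Normal component of the relative velocity of the pair $i$-$j$: $\eta_{i,j}=(v_j-v_i)\cdot\frac{x_j-x_i}{|x_j-x_i|}$; $\eta_{(i,j),n}$ is its value just before the $n$-th collision, counting collisions of all types. Maximal gap: let $\varphi^{(i,j)}(n)$ be the index, among all the collisions of the system, of the $n$-th collision of type $i$-$j$. For a pair colliding infinitely many times, the maximal gap of type $(i,j)$ is $\sup_{n\ge1}[\varphi^{(i,j)}(n+1)-\varphi^{(i,j)}(n)]$; the system has a finite maximal gap of type $(i,j)$ if this is finite. *)

theory Defs
  imports "HOL-Analysis.Analysis" "HOL-Library.Infinite_Set" "HOL-Library.Extended_Nat"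
begin

text \<open>
  Particles are the indices in \<open>{0, 1, 2}\<close>. A motion is given by the positions \<open>x i t\<close> and by the
  velocities \<open>u i t\<close> just before and \<open>w i t\<close> just after time \<open>t\<close>. At \<open>t = 0\<close> the former is
  the incoming initial velocity, so that a collision at the initial time is meaningful.
  Only the values at times in \<open>{0..<\<tau>}\<close> matter.
\<close>

type_synonym 'd motion = "nat \<Rightarrow> real \<Rightarrow> real ^ 'd"

definition particles :: "nat set" where
  "particles = {0, 1, 2}"

definition in_contact :: "('d::finite) motion \<Rightarrow> nat \<Rightarrow> nat \<Rightarrow> real \<Rightarrow> bool" where
  "in_contact x i j t \<longleftrightarrow> norm (x i t - x j t) = 1"

definition collision_times :: "real \<Rightarrow> ('d::finite) motion \<Rightarrow> real set" where
  "collision_times \<tau> x =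
     {t \<in> {0..<\<tau>}. \<exists>i\<in>particles. \<exists>j\<in>particles. i \<noteq> j \<and> in_contact x i j t}"

definition inelastic_hard_sphere_flow ::
  "real \<Rightarrow> real \<Rightarrow> ('d::finite) motion \<Rightarrow> 'd motion \<Rightarrow> 'd motion \<Rightarrow> bool" where
  "inelastic_hard_sphere_flow r \<tau> x u w \<longleftrightarrow>
     (\<forall>t\<in>{0..<\<tau>}. \<forall>i\<in>particles. \<forall>j\<in>particles. i \<noteq> j \<longrightarrow> norm (x i t - x j t) \<ge> 1) \<and>
     (\<forall>s t. 0 \<le> s \<and> s < t \<and> t < \<tau> \<and> {s<..<t} \<inter> collision_times \<tau> x = {} \<longrightarrow>
        (\<forall>i\<in>particles. x i t = x i s + (t - s) *\<^sub>R w i s \<and> u i t = w i s)) \<and>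
     (\<forall>t\<in>{0..<\<tau>} - collision_times \<tau> x. \<forall>i\<in>particles. w i t = u i t) \<and>
     (\<forall>t\<in>{0..<\<tau>}. \<forall>i\<in>particles. \<forall>j\<in>particles. i \<noteq> j \<and> in_contact x i j t \<longrightarrow>
        (let \<omega> = (x i t - x j t) /\<^sub>R norm (x i t - x j t) in
           w i t = u i t - ((1 + r) / 2 * ((u i t - u j t) \<bullet> \<omega>)) *\<^sub>R \<omega> \<and>
           w j t = u j t + ((1 + r) / 2 * ((u i t - u j t) \<bullet> \<omega>)) *\<^sub>R \<omega> \<and>
           (\<forall>k\<in>particles - {i, j}. w k t = u k t)))"

definition normal_relative_velocity ::
  "('d::finite) motion \<Rightarrow> 'd motion \<Rightarrow> nat \<Rightarrow> nat \<Rightarrow> real \<Rightarrow> real" where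
  "normal_relative_velocity x u i j t =
     (u j t - u i t) \<bullet> ((x j t - x i t) /\<^sub>R norm (x j t - x i t))"

definition no_triple_collision :: "real \<Rightarrow> ('d::finite) motion \<Rightarrow> bool" where
  "no_triple_collision \<tau> x \<longleftrightarrow>
     (\<forall>t\<in>{0..<\<tau>}. \<forall>i\<in>particles. \<forall>j\<in>particles. \<forall>k\<in>particles.
        i \<noteq> j \<and> j \<noteq> k \<and> i \<noteq> k \<longrightarrow> \<not> (in_contact x i j t \<and> in_contact x j k t))"

definition no_grazing_collision ::
  "real \<Rightarrow> ('d::finite) motion \<Rightarrow> 'd motion \<Rightarrow> bool" where
  "no_grazing_collision \<tau> x u \<longleftrightarrow>
     (\<forall>t\<in>{0..<\<tau>}. \<forall>i\<in>particles. \<forall>j\<in>particles.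
        i \<noteq> j \<and> in_contact x i j t \<longrightarrow> normal_relative_velocity x u i j t \<noteq> 0)"

text \<open>
  The sequence \<open>c\<close> lists all the collision times in increasing order; the initial time \<open>0\<close> may or
  may not be one of them. The collapse sequence starting at \<open>0\<close> is \<open>c\<close> itself if \<open>c 0 = 0\<close>,
  and \<open>c\<close> with \<open>0\<close> prepended otherwise.
\<close>

definition inelastic_collapse ::
  "real \<Rightarrow> real \<Rightarrow> ('d::finite) motion \<Rightarrow> 'd motion \<Rightarrow> 'd motion \<Rightarrow> (nat \<Rightarrow> real) \<Rightarrow> bool" where
  "inelastic_collapse r \<tau> x u w c \<longleftrightarrow>
     0 < \<tau> \<and>
     inelastic_hard_sphere_flow r \<tau> x u w \<and>
     no_triple_collision \<tau> x \<and>
     no_grazing_collision \<tau> x u \<and>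
     strict_mono c \<and>
     range c = collision_times \<tau> x \<and>
     c \<longlonglongrightarrow> \<tau>"

definition collision_indices ::
  "('d::finite) motion \<Rightarrow> (nat \<Rightarrow> real) \<Rightarrow> nat \<Rightarrow> nat \<Rightarrow> nat set" where
  "collision_indices x c i j = {n. in_contact x i j (c n)}"

text \<open>
  Collisions are counted from \<open>0\<close>; this does not affect the gaps. The subtraction is not
  truncated when the pair collides infinitely often, since \<open>enumerate\<close> is then increasing.
\<close>

definition maximal_gap ::
  "('d::finite) motion \<Rightarrow> (nat \<Rightarrow> real) \<Rightarrow> nat \<Rightarrow> nat \<Rightarrow> enat" where
  "maximal_gap x c i j =
     (SUP n. enat (enumerate (collision_indices x c i j) (Suc n)
                   - enumerate (collision_indices x c i j) n))"

end

theory Submission imports Defs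
begin

text \<open>
  A collision with normal relative velocity \<open>\<eta>\<close> dissipates the kinetic energy
  \<open>(1 - r\<^sup>2) / 4 * \<eta>\<^sup>2\<close>, so the velocity jumps are square summable over all the collisions.
  Between two collisions \<open>\<eta>\<^bsub>(i,j)\<^esub>\<close> only varies because the direction \<open>\<omega>\<^bsub>ij\<^esub>\<close> rotates,
  by an amount of the order of the elapsed time, and the durations are summable. Hence
  \<open>\<bar>\<eta>\<^bsub>(i,j),n+1\<^esub>\<bar> \<le> \<bar>\<eta>\<^bsub>(i,j),n\<^esub>\<bar> + b\<^sub>n\<close> with \<open>b\<close> in \<open>\<ell>\<^sup>2\<close>, while \<open>\<bar>\<eta>\<^bsub>(i,j),n\<^esub>\<bar> \<le> b\<^sub>n\<close>
  when the \<open>n\<close>-th collision is of type \<open>(i,j)\<close>. A finite maximal gap bounds \<open>\<bar>\<eta>\<^bsub>(i,j),n\<^esub>\<bar>\<close>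
  by twice the sum of a fixed number of terms \<open>b\<^sub>k\<close> preceding \<open>n\<close>.
\<close>

section \<open>Sequences controlled along a set of indices with bounded gaps\<close>

lemma enumerate_gap_bounded:
  fixes S :: "nat set"
  assumes S: "infinite S"
    and gap: "\<And>k. enumerate S (Suc k) - enumerate S k \<le> g"
    and n: "enumerate S 0 \<le> n"
  obtains m where "m \<in> S" "m \<le> n" "n - m \<le> g"
proof -
  have fin: "finite {k. enumerate S k \<le> n}"
    by (rule finite_subset[of _ "{..n}"]) (use le_enumerate[OF S] order_trans in auto)
  \<comment> \<open>This numbers the last element of \<open>S\<close> not exceeding
    \<open>n\<close>. The next element lies beyond \<open>n\<close>, so \<open>n\<close> is less
    than one gap away.\<close>
  define k where "k = Max {k. enumerate S k \<le> n}"
  have k: "enumerate S k \<le> n"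
    using Max_in[OF fin] n by (auto simp: k_def)
  have "\<not> enumerate S (Suc k) \<le> n"
    using Max_ge[OF fin, of "Suc k"] by (auto simp: k_def)
  then have "n - enumerate S k \<le> g"
    using gap[of k] by linarith
  then show thesis
    using that k enumerate_in_set[OF S] by blast
qed

text \<open>Going back from \<open>n\<close> to the nearest earlier index in \<open>S\<close> takes
  at most \<open>g\<close> steps, so \<open>a n\<close> is dominated by a window of
  \<open>g + 1\<close> terms of \<open>b\<close>. Such a window is a finite sum of shifts of
  \<open>b\<close>, each of them in l^2.\<close>

lemma summable_square_of_bounded_gaps:
  fixes a b :: "nat \<Rightarrow> real"
  assumes a: "\<And>n. 0 \<le> a n" and b: "\<And>n. 0 \<le> b n"
    and step: "\<And>n. a (Suc n) \<le> a n + b n"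
    and base: "\<And>m. m \<in> S \<Longrightarrow> a m \<le> b m"
    and gap: "\<And>n. N \<le> n \<Longrightarrow> \<exists>m\<in>S. m \<le> n \<and> n - m \<le> g"
    and sum: "summable (\<lambda>n. (b n)\<^sup>2)"
  shows "summable (\<lambda>n. (a n)\<^sup>2)"
proof (rule summable_comparison_test)
  \<comment> \<open>Truncated subtraction repeats \<open>b 0\<close> for the first \<open>l\<close>
    indices, which does not affect convergence.\<close>
  have "summable (\<lambda>n. (b (n - l))\<^sup>2)" for l
    using summable_iff_shift[of "\<lambda>n. (b (n - l))\<^sup>2" l] sum by simp
  then show "summable (\<lambda>n. 4 * ((\<Sum>l\<le>g. (b (n - l))\<^sup>2) * card {..g}))"
    by (intro summable_mult summable_mult2 summable_sum)
  \<comment> \<open>The extra \<open>b (m + p)\<close> on the left absorbs the increment of the next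
    step. The factor 2 comes from the base case, where \<open>b m\<close> pays both for
    \<open>a m\<close> and for this extra term.\<close>
  have le_sum: "a (m + p) + b (m + p) \<le> 2 * (\<Sum>l\<le>p. b (m + p - l))" if "m \<in> S" for m p
  proof (induction p)
    case 0
    then show ?case using base[OF that] by simp
  next
    case (Suc p)
    have "(\<Sum>l\<le>Suc p. b (m + Suc p - l)) = b (m + Suc p) + (\<Sum>l\<le>p. b (m + p - l))"
      by (subst sum.atMost_Suc_shift) simp
    with Suc show ?case
      using step[of "m + p"] b[of "m + Suc p"] by simp
  qed
  show "\<exists>N. \<forall>n\<ge>N. norm ((a n)\<^sup>2) \<le> 4 * ((\<Sum>l\<le>g. (b (n - l))\<^sup>2) * card {..g})"
  proof (intro exI allI impI)
    fix n assume "N \<le> n"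
    then obtain m where m: "m \<in> S" "m \<le> n" "n - m \<le> g" using gap by blast
    have "a n \<le> 2 * (\<Sum>l\<le>n - m. b (n - l))"
      using le_sum[OF m(1), of "n - m"] m(2) b[of n] by simp
    also have "\<dots> \<le> 2 * (\<Sum>l\<le>g. b (n - l))"
      using m(3) b by (intro mult_left_mono sum_mono2) auto
    finally have "(a n)\<^sup>2 \<le> (2 * (\<Sum>l\<le>g. b (n - l)))\<^sup>2"
      using a by (intro power_mono) auto
    also have "\<dots> = 4 * (\<Sum>l\<le>g. b (n - l))\<^sup>2"
      by (simp add: power_mult_distrib)
    also have "\<dots> \<le> 4 * ((\<Sum>l\<le>g. (b (n - l))\<^sup>2) * card {..g})"
      by (intro mult_left_mono sum_squared_le_sum_of_squares) auto
    finally show "norm ((a n)\<^sup>2) \<le> 4 * ((\<Sum>l\<le>g. (b (n - l))\<^sup>2) * card {..g})" by simp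
  qed
qed

section \<open>Geometry and energy balance of a single collision\<close>

lemma norm_sgn_diff_le:
  fixes x y :: "'a::real_inner"
  assumes "1 \<le> norm x" "1 \<le> norm y"
  shows "norm (sgn x - sgn y) \<le> 2 * norm (x - y)"
proof -
  \<comment> \<open>Both terms on the right have norm at most \<open>norm (x - y)\<close>, the
    second by the reverse triangle inequality. Dividing by \<open>norm x\<close>, which is at least
    1, then gives the bound.\<close>
  have "norm x *\<^sub>R (sgn x - sgn y) = (x - y) + (norm y - norm x) *\<^sub>R sgn y"
    using assms by (cases "x = 0"; cases "y = 0") (auto simp: sgn_div_norm algebra_simps)
  then have "norm x * norm (sgn x - sgn y) = norm ((x - y) + (norm y - norm x) *\<^sub>R sgn y)"
    by (metis abs_norm_cancel norm_scaleR)
  also have "\<dots> \<le> norm (x - y) + \<bar>norm y - norm x\<bar> * norm (sgn y)"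
    by (rule norm_triangle_le) simp
  also have "\<dots> \<le> norm (x - y) + norm (x - y) * 1"
    using norm_triangle_ineq3[of y x]
    by (intro add_left_mono mult_mono) (auto simp: norm_sgn norm_minus_commute)
  finally have "norm x * norm (sgn x - sgn y) \<le> 2 * norm (x - y)" by simp
  moreover have "1 * norm (sgn x - sgn y) \<le> norm x * norm (sgn x - sgn y)"
    using assms by (intro mult_right_mono) auto
  ultimately show ?thesis by simp
qed

text \<open>With \<open>J\<close> equal to \<open>s\<close> times the unit vector
  \<open>\<omega>\<close> and \<open>e\<close> the normal relative velocity, the loss is 2 s e - 2
  s^2; now put s = (1 + r) e / 2.\<close>

lemma inelastic_energy_loss:
  fixes a b \<omega> :: "'a::real_inner" and r :: real
  assumes "norm \<omega> = 1"
  defines "J \<equiv> ((1 + r) / 2 * ((a - b) \<bullet> \<omega>)) *\<^sub>R \<omega>"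
  shows "(norm a)\<^sup>2 + (norm b)\<^sup>2 - ((norm (a - J))\<^sup>2 + (norm (b + J))\<^sup>2)
           = (1 - r\<^sup>2) / 2 * ((a - b) \<bullet> \<omega>)\<^sup>2"
proof -
  define e where "e = (a - b) \<bullet> \<omega>"
  define s where "s = (1 + r) / 2 * e"
  have J: "J = s *\<^sub>R \<omega>" by (simp add: J_def s_def e_def)
  have w: "\<omega> \<bullet> \<omega> = 1" using assms(1) by (simp add: norm_eq_1)
  have "(norm a)\<^sup>2 + (norm b)\<^sup>2 - ((norm (a - J))\<^sup>2 + (norm (b + J))\<^sup>2)
          = 2 * s * (a \<bullet> \<omega> - b \<bullet> \<omega>) - 2 * s\<^sup>2"
    unfolding J power2_norm_eq_inner
    by (simp add: inner_simps inner_commute w algebra_simps power2_eq_square)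
  also have "a \<bullet> \<omega> - b \<bullet> \<omega> = e" by (simp add: e_def inner_diff_left)
  also have "2 * s * e - 2 * s\<^sup>2 = (1 - r\<^sup>2) / 2 * e\<^sup>2"
    by (simp add: s_def power2_eq_square field_simps)
  finally show ?thesis by (simp add: e_def)
qed

text \<open>Twice the kinetic energy for unit masses, hence the factor (1 - r^2)/2 instead of (1 -
  r^2)/4 below. It applies to incoming and outgoing velocities alike.\<close>

definition velocity_energy :: "('d::finite) motion \<Rightarrow> real \<Rightarrow> real" where
  "velocity_energy v t = (\<Sum>p\<in>particles. (norm (v p t))\<^sup>2)"

lemma velocity_energy_nonneg: "0 \<le> velocity_energy v t"
  by (simp add: velocity_energy_def sum_nonneg)

lemma norm_square_le_velocity_energy:
  "p \<in> particles \<Longrightarrow> (norm (v p t))\<^sup>2 \<le> velocity_energy v t"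
  unfolding velocity_energy_def by (rule member_le_sum) (auto simp: particles_def)

lemma flow_free_motion:
  assumes "inelastic_hard_sphere_flow r \<tau> x u w"
    and "0 \<le> s" "s < t" "t < \<tau>" "{s<..<t} \<inter> collision_times \<tau> x = {}" "p \<in> particles"
  shows "x p t = x p s + (t - s) *\<^sub>R w p s" "u p t = w p s"
  using assms unfolding inelastic_hard_sphere_flow_def by blast+

lemma collision_energy_loss:
  assumes flow: "inelastic_hard_sphere_flow r \<tau> x u w"
    and t: "t \<in> {0..<\<tau>}"
    and ij: "i \<in> particles" "j \<in> particles" "i \<noteq> j" "in_contact x i j t"
  shows "velocity_energy u t - velocity_energy w t
           = (1 - r\<^sup>2) / 2 * (normal_relative_velocity x u i j t)\<^sup>2"
    and "p \<in> particles \<Longrightarrow>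
           norm (w p t - u p t) \<le> \<bar>(1 + r) / 2\<bar> * \<bar>normal_relative_velocity x u i j t\<bar>"
proof -
  define \<omega> where "\<omega> = (x i t - x j t) /\<^sub>R norm (x i t - x j t)"
  define J where "J = ((1 + r) / 2 * ((u i t - u j t) \<bullet> \<omega>)) *\<^sub>R \<omega>"
  have w: "w i t = u i t - J" "w j t = u j t + J" "\<And>k. k \<in> particles - {i, j} \<Longrightarrow> w k t = u k t"
    using flow t ij unfolding inelastic_hard_sphere_flow_def Let_def J_def \<omega>_def by blast+
  have n\<omega>: "norm \<omega> = 1"
    using ij(4) by (simp add: \<omega>_def in_contact_def)
  \<comment> \<open>The collision rule and \<open>normal_relative_velocity\<close> order the pair
    oppositely; the two sign changes cancel.\<close>
  have "normal_relative_velocity x u i j t = (- (u i t - u j t)) \<bullet> (- \<omega>)"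
    unfolding normal_relative_velocity_def \<omega>_def by (simp add: norm_minus_commute scaleR_diff_right)
  then have \<eta>: "normal_relative_velocity x u i j t = (u i t - u j t) \<bullet> \<omega>"
    by (simp only: inner_minus_left inner_minus_right minus_minus)
  have split: "velocity_energy v t = (norm (v i t))\<^sup>2 + (norm (v j t))\<^sup>2
      + (\<Sum>p\<in>particles - {i, j}. (norm (v p t))\<^sup>2)" for v :: "nat \<Rightarrow> real \<Rightarrow> real ^ 'a"
  proof -
    have "finite particles" by (simp add: particles_def)
    then show ?thesis
      using ij unfolding velocity_energy_def
      by (subst sum.subset_diff[of "{i, j}"]) auto
  qed
  show "velocity_energy u t - velocity_energy w t
          = (1 - r\<^sup>2) / 2 * (normal_relative_velocity x u i j t)\<^sup>2"
    using inelastic_energy_loss[OF n\<omega>, of "u i t" "u j t" r]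
    unfolding split \<eta> by (simp add: w J_def)
  show "norm (w p t - u p t) \<le> \<bar>(1 + r) / 2\<bar> * \<bar>normal_relative_velocity x u i j t\<bar>"
    if "p \<in> particles"
  proof -
    have "norm J = \<bar>(1 + r) / 2\<bar> * \<bar>normal_relative_velocity x u i j t\<bar>"
      by (simp add: J_def \<eta> n\<omega> abs_mult)
    then show ?thesis
      using w that by (cases "p = i"; cases "p = j") auto
  qed
qed

theorem proposition3:
  fixes r \<tau> :: real
    and x u w :: "nat \<Rightarrow> real \<Rightarrow> real ^ 'd"
    and c :: "nat \<Rightarrow> real"
    and i j :: nat
  assumes "CARD('d) \<ge> 2"
    and "0 < r" and "r < 1"
    and "inelastic_collapse r \<tau> x u w c"
    and "(i, j) \<in> {(0, 1), (0, 2), (1, 2)}"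
    and "infinite (collision_indices x c i j)"
    and "maximal_gap x c i j < \<infinity>"
  shows "summable (\<lambda>n. (normal_relative_velocity x u i j (c n))\<^sup>2) \<and>
         (\<lambda>n. normal_relative_velocity x u i j (c n)) \<longlonglongrightarrow> 0"
proof -
  let ?\<eta> = "\<lambda>n. normal_relative_velocity x u i j (c n)"
  let ?S = "collision_indices x c i j"

  \<comment> \<open>Free flight between consecutive collisions\<close>
  have flow: "inelastic_hard_sphere_flow r \<tau> x u w"
    and mono: "strict_mono c" and range: "range c = collision_times \<tau> x"
    and lim: "c \<longlonglongrightarrow> \<tau>"
    using assms(4) by (auto simp: inelastic_collapse_def)
  have ij: "i \<in> particles" "j \<in> particles" "i \<noteq> j"
    using assms(5) by (auto simp: particles_def)
  have c: "c n \<in> collision_times \<tau> x" for n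
    using range by blast
  then have ct: "c n \<in> {0..<\<tau>}" for n
    by (auto simp: collision_times_def)
  have free: "x p (c (Suc n)) = x p (c n) + (c (Suc n) - c n) *\<^sub>R w p (c n)"
      "u p (c (Suc n)) = w p (c n)" if "p \<in> particles" for p n
  proof -
    have "{c n<..<c (Suc n)} \<inter> collision_times \<tau> x = {}"
      unfolding range[symmetric] using mono by (auto simp: strict_mono_less)
    moreover have "c n < c (Suc n)" using mono by (simp add: strict_mono_Suc_iff)
    ultimately show "x p (c (Suc n)) = x p (c n) + (c (Suc n) - c n) *\<^sub>R w p (c n)"
      "u p (c (Suc n)) = w p (c n)"
      using flow_free_motion[OF flow] that ct[of n] ct[of "Suc n"] by auto
  qed
  have sep: "1 \<le> norm (x j (c n) - x i (c n))" for n
    using flow ct[of n] ij by (auto simp: inelastic_hard_sphere_flow_def)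

  \<comment> \<open>Square summability of the velocity jumps\<close>
  define E where "E n = velocity_energy u (c n)" for n
  have E_Suc: "E (Suc n) = velocity_energy w (c n)" for n
    by (simp add: E_def velocity_energy_def free)
  \<comment> \<open>\<open>K\<close> is normalised so that \<open>e n\<close> is the modulus of the
    normal relative velocity of whichever pair collides at \<open>c n\<close>. Defining
    \<open>e\<close> through the energy avoids choosing that pair.\<close>
  define K where "K = 2 / (1 - r\<^sup>2)"
  define e where "e n = sqrt (K * (E n - E (Suc n)))" for n
  have "r\<^sup>2 < 1" using assms(2,3) by (simp add: abs_square_less_1)
  then have K: "0 < K" "K * ((1 - r\<^sup>2) / 2) = 1"
    by (simp_all add: K_def)
  have e_eq: "e n = \<bar>normal_relative_velocity x u k l (c n)\<bar>"
    if "k \<in> particles" "l \<in> particles" "k \<noteq> l" "in_contact x k l (c n)" for n k l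
  proof -
    have "K * (E n - E (Suc n))
            = K * ((1 - r\<^sup>2) / 2) * (normal_relative_velocity x u k l (c n))\<^sup>2"
      using collision_energy_loss(1)[OF flow ct that] by (simp only: E_Suc E_def[of n] mult.assoc)
    then show ?thesis by (simp only: e_def K(2) mult_1 real_sqrt_abs)
  qed
  have e_nonneg: "0 \<le> e n" and jump: "p \<in> particles \<Longrightarrow> norm (w p (c n) - u p (c n)) \<le> e n" for n p
  proof -
    obtain k l where kl: "k \<in> particles" "l \<in> particles" "k \<noteq> l" "in_contact x k l (c n)"
      using c[of n] by (auto simp: collision_times_def)
    show "0 \<le> e n" using e_eq[OF kl] by simp
    assume "p \<in> particles"
    from collision_energy_loss(2)[OF flow ct kl this]
    have "norm (w p (c n) - u p (c n)) \<le> \<bar>(1 + r) / 2\<bar> * e n"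
      using e_eq[OF kl] by simp
    also have "\<dots> \<le> 1 * e n"
      using assms(2,3) \<open>0 \<le> e n\<close> by (intro mult_right_mono) auto
    finally show "norm (w p (c n) - u p (c n)) \<le> e n" by simp
  qed
  have e_sq: "(e n)\<^sup>2 = K * (E n - E (Suc n))" for n
    using e_nonneg[of n] by (simp add: e_def)
  have E_mono: "E (Suc n) \<le> E n" for n
    using e_sq[of n] K(1) by (smt (verit) zero_le_power2 zero_le_mult_iff)
  then have "decseq E" by (simp add: decseq_SucI)
  have "convergent E"
  proof (rule Bseq_monoseq_convergent)
    show "Bseq E"
      using \<open>decseq E\<close> velocity_energy_nonneg[of u]
      by (intro decseq_bounded[of E 0]) (auto simp: E_def)
    show "monoseq E" using \<open>decseq E\<close> by (simp add: decseq_imp_monoseq)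
  qed
  then obtain E0 where "E \<longlonglongrightarrow> E0" by (auto simp: convergent_def)
  \<comment> \<open>The squares are \<open>K\<close> times the differences of a convergent sequence,
    so their series telescopes.\<close>
  then have sum_e: "summable (\<lambda>n. (e n)\<^sup>2)"
    unfolding e_sq by (intro summable_mult telescope_summable')

  \<comment> \<open>Variation of the normal relative velocity from one collision to the next\<close>
  define V where "V = 2 * sqrt (E 0)"
  have V: "norm (w j (c n) - w i (c n)) \<le> V" for n
  proof -
    have "norm (w p (c n)) \<le> sqrt (E 0)" if "p \<in> particles" for p
      using norm_square_le_velocity_energy[OF that, of w "c n"] decseqD[OF \<open>decseq E\<close>, of 0 "Suc n"]
      by (intro real_le_rsqrt) (simp add: E_Suc)
    from this[OF ij(1)] this[OF ij(2)] show ?thesis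
      unfolding V_def using norm_triangle_ineq4[of "w j (c n)" "w i (c n)"] by linarith
  qed
  have V0: "0 \<le> V" using V[of 0] norm_ge_zero order_trans by blast

  define \<delta> where "\<delta> n = c (Suc n) - c n" for n
  have \<delta>: "0 \<le> \<delta> n" for n using mono by (simp add: \<delta>_def strict_mono_less_eq)
  have "summable \<delta>"
    using lim unfolding \<delta>_def by (rule telescope_summable)
  have sum_\<delta>: "summable (\<lambda>n. (\<delta> n)\<^sup>2)"
  proof (rule summable_comparison_test)
    show "summable (\<lambda>n. \<tau> * \<delta> n)" using \<open>summable \<delta>\<close> by (rule summable_mult)
    have "\<delta> n \<le> \<tau>" for n using ct[of n] ct[of "Suc n"] by (simp add: \<delta>_def)
    then show "\<exists>N. \<forall>n\<ge>N. norm ((\<delta> n)\<^sup>2) \<le> \<tau> * \<delta> n"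
      using \<delta> by (auto simp: power2_eq_square intro: mult_right_mono)
  qed
  \<comment> \<open>The first term covers the jumps of the two velocities, each at most
    \<open>e n\<close>. The second covers the rotation of the direction: a displacement of at most
    \<open>V * \<delta> n\<close>, doubled by normalisation, then multiplied by the bound
    \<open>V\<close> on the relative velocity.\<close>
  define b where "b n = 2 * e n + 2 * V\<^sup>2 * \<delta> n" for n
  have step: "\<bar>?\<eta> (Suc n)\<bar> \<le> \<bar>?\<eta> n\<bar> + b n" for n
  proof -
    define X where "X n = x j (c n) - x i (c n)" for n
    define W where "W = w j (c n) - w i (c n)"
    define U where "U = u j (c n) - u i (c n)"
    have \<eta>n: "?\<eta> n = U \<bullet> sgn (X n)"
      by (simp add: normal_relative_velocity_def U_def X_def sgn_div_norm)
    have "?\<eta> (Suc n) = W \<bullet> sgn (X (Suc n))"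
      by (simp add: normal_relative_velocity_def W_def X_def sgn_div_norm free ij)
    \<comment> \<open>The change is split into a velocity jump in a fixed direction and a rotation
      of the direction at fixed outgoing velocity.\<close>
    also have "\<dots> = U \<bullet> sgn (X n) + (W - U) \<bullet> sgn (X n) + W \<bullet> (sgn (X (Suc n)) - sgn (X n))"
      by (simp add: inner_simps)
    finally have "\<bar>?\<eta> (Suc n)\<bar> \<le> \<bar>?\<eta> n\<bar> + \<bar>(W - U) \<bullet> sgn (X n)\<bar>
        + \<bar>W \<bullet> (sgn (X (Suc n)) - sgn (X n))\<bar>"
      unfolding \<eta>n by linarith
    moreover have "\<bar>(W - U) \<bullet> sgn (X n)\<bar> \<le> 2 * e n"
    proof -
      have "\<bar>(W - U) \<bullet> sgn (X n)\<bar> \<le> norm (W - U) * norm (sgn (X n))"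
        by (rule Cauchy_Schwarz_ineq2)
      also have "\<dots> \<le> norm (W - U)" by (simp add: norm_sgn)
      also have "\<dots> = norm ((w j (c n) - u j (c n)) - (w i (c n) - u i (c n)))"
        by (simp add: W_def U_def algebra_simps)
      also have "\<dots> \<le> norm (w j (c n) - u j (c n)) + norm (w i (c n) - u i (c n))"
        by (rule norm_triangle_ineq4)
      also have "\<dots> \<le> 2 * e n"
        using jump[OF ij(1), of n] jump[OF ij(2), of n] by linarith
      finally show ?thesis .
    qed
    moreover have "\<bar>W \<bullet> (sgn (X (Suc n)) - sgn (X n))\<bar> \<le> 2 * V\<^sup>2 * \<delta> n"
    proof -
      have XW: "X (Suc n) - X n = \<delta> n *\<^sub>R W"
        by (simp add: X_def W_def \<delta>_def free ij algebra_simps)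
      have "\<bar>W \<bullet> (sgn (X (Suc n)) - sgn (X n))\<bar> \<le> norm W * norm (sgn (X (Suc n)) - sgn (X n))"
        by (rule Cauchy_Schwarz_ineq2)
      also have "\<dots> \<le> norm W * (2 * norm (X (Suc n) - X n))"
        using sep by (intro mult_left_mono norm_sgn_diff_le) (auto simp: X_def)
      also have "\<dots> = 2 * (norm W)\<^sup>2 * \<delta> n"
        using \<delta>[of n] by (simp add: XW power2_eq_square)
      also have "\<dots> \<le> 2 * V\<^sup>2 * \<delta> n"
        using V[of n] V0 \<delta>[of n] by (intro mult_right_mono mult_left_mono power_mono) (auto simp: W_def)
      finally show ?thesis .
    qed
    ultimately show ?thesis by (simp add: b_def)
  qed
  have b_nonneg: "0 \<le> b n" and e_le_b: "e n \<le> b n" for n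
    using e_nonneg[of n] \<delta>[of n] by (auto simp: b_def)
  have sum_b: "summable (\<lambda>n. (b n)\<^sup>2)"
  proof (rule summable_comparison_test)
    show "summable (\<lambda>n. 8 * (e n)\<^sup>2 + 8 * V ^ 4 * (\<delta> n)\<^sup>2)"
      using sum_e sum_\<delta> by (intro summable_add summable_mult)
    have "(b n)\<^sup>2 \<le> 8 * (e n)\<^sup>2 + 8 * V ^ 4 * (\<delta> n)\<^sup>2" for n
    proof -
      \<comment> \<open>This is (p + q)^2 <= 2 p^2 + 2 q^2 for the two terms of
        \<open>b n\<close>.\<close>
      have "0 \<le> (2 * e n - 2 * V\<^sup>2 * \<delta> n)\<^sup>2" by simp
      then show ?thesis
        by (simp add: b_def power2_eq_square power4_eq_xxxx algebra_simps)
    qed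
    then show "\<exists>N. \<forall>n\<ge>N. norm ((b n)\<^sup>2) \<le> 8 * (e n)\<^sup>2 + 8 * V ^ 4 * (\<delta> n)\<^sup>2" by simp
  qed

  \<comment> \<open>Use of the finite maximal gap\<close>
  obtain g where g: "maximal_gap x c i j = enat g"
    using assms(7) by (cases "maximal_gap x c i j") auto
  have gap_le: "enumerate ?S (Suc k) - enumerate ?S k \<le> g" for k
  proof -
    have "enat (enumerate ?S (Suc k) - enumerate ?S k) \<le> maximal_gap x c i j"
      unfolding maximal_gap_def by (rule SUP_upper) simp
    then show ?thesis unfolding g by (simp only: enat_ord_simps)
  qed
  \<comment> \<open>Before the first collision of the pair there is no earlier index to go back to;
    these finitely many terms do not affect summability.\<close>
  have gap: "\<exists>m\<in>?S. m \<le> n \<and> n - m \<le> g" if "enumerate ?S 0 \<le> n" for n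
    by (rule enumerate_gap_bounded[OF assms(6) gap_le that]) blast

  have "summable (\<lambda>n. \<bar>?\<eta> n\<bar>\<^sup>2)"
  proof (rule summable_square_of_bounded_gaps[OF _ b_nonneg step _ gap sum_b])
    \<comment> \<open>When the pair itself collides, its normal relative velocity is the one
      measured by \<open>e m\<close>.\<close>
    show "\<bar>?\<eta> m\<bar> \<le> b m" if "m \<in> ?S" for m
      using e_eq[OF ij, of m] e_le_b[of m] that by (simp add: collision_indices_def)
  qed auto
  then have sum_\<eta>: "summable (\<lambda>n. (?\<eta> n)\<^sup>2)" by simp
  moreover have "?\<eta> \<longlonglongrightarrow> 0"
    using tendsto_real_sqrt[OF summable_LIMSEQ_zero[OF sum_\<eta>]] by (simp add: tendsto_rabs_zero_iff)
  ultimately show ?thesis by blast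
qed

end
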